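(* Let $(\mathcal{N},[\cdot,\dots,\cdot],\alpha,B,\beta)$ be a Hom-quadratic multiplicative $n$-ary Hom-Nambu algebra. For $k\ge 1$ define the $(2^k(n-1)+1)$-ary product $[\cdot,\dots,\cdot]^{(k)}$ inductively by setting $[\cdot,\dots,\cdot]^{(0)}=[\cdot,\dots,\cdot]$ and $$[x_1,\dots,x_{2^k(n-1)+1}]^{(k)}=\big[[x_1,\dots,x_{2^{k-1}(n-1)+1}]^{(k-1)},\alpha^{2^{k-1}}(x_{2^{k-1}(n-1)+2}),\dots,\alpha^{2^{k-1}}(x_{2^k(n-1)+1})\big]^{(k-1)}$$ for all $x_i\in\mathcal{N}$. Then, for every $k\ge1$, $\mathcal{N}^k=(\mathcal{N},[\cdot,\dots,\cdot]^{(k)},\alpha^{2^k},B,\beta')$, where $\beta'=\beta\circ\alpha^{2^k-1}$, is a Hom-quadratic multiplicative $(2^k(n-1)+1)$-ary Hom-Nambu algebra.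
   Context: $\mathbb{K}$ is an algebraically closed field of characteristic zero and $n\ge 2$. A multiplicative $n$-ary Hom-Nambu algebra $(\mathcal{N},[\cdot,\dots,\cdot],\alpha)$ is a $\mathbb{K}$-vector space $\mathcal{N}$ with an $n$-linear map $[\cdot,\dots,\cdot]:\mathcal{N}^n\to\mathcal{N}$ (not assumed skew-symmetric) and a linear map $\alpha:\mathcal{N}\to\mathcal{N}$ such that $\alpha([x_1,\dots,x_n])=[\alpha(x_1),\dots,\alpha(x_n)]$ and $$[\alpha(x_1),\dots,\alpha(x_{n-1}),[y_1,\dots,y_n]]=\sum_{i=1}^n[\alpha(y_1),\dots,\alpha(y_{i-1}),[x_1,\dots,x_{n-1},y_i],\alpha(y_{i+1}),\dots,\alpha(y_n)].$$ It is Hom-quadratic with $(B,\beta)$, written $(\mathcal{N},[\cdot,\dots,\cdot],\alpha,B,\beta)$, if $B$ is a nondegenerate symmetric bilinear form on $\mathcal{N}$ and $\beta\in End(\mathcal{N})$ satisfies $B([x_1,\dots,x_{n-1},y],\beta(z))+B(\beta(y),[x_1,\dots,x_{n-1},z])=0$ for all elements. *)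

theory Defs
  imports Complex_Main "HOL-Computational_Algebra.Polynomial"
begin

text \<open>An \<open>n\<close>-ary operation on a type \<open>'v\<close> is modelled as a function \<open>'v list \<Rightarrow> 'v\<close>; only its
  values on lists of length \<open>n\<close> are meaningful, and nothing is required of its values on
  lists of other lengths. A vector space is a type \<open>'v\<close> with a scalar multiplication
  satisfying the library locale \<^locale>\<open>vector_space\<close>. List positions count from \<open>0\<close>.\<close>

definition multilinear ::
  "('k::field \<Rightarrow> 'v::ab_group_add \<Rightarrow> 'v) \<Rightarrow> nat \<Rightarrow> ('v list \<Rightarrow> 'v) \<Rightarrow> bool"
  where "multilinear scale n br \<longleftrightarrow>
    (\<forall>xs i. length xs = n \<longrightarrow> i < n \<longrightarrow> Vector_Spaces.linear scale scale (\<lambda>v. br (xs[i := v])))"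

locale hom_nambu_algebra = vector_space scale
  for scale :: "'k::field \<Rightarrow> 'v::ab_group_add \<Rightarrow> 'v" +
  fixes n :: nat
    and br :: "'v list \<Rightarrow> 'v"
    and \<alpha> :: "'v \<Rightarrow> 'v"
  assumes arity: "n \<ge> 2"
    and br_multilinear: "multilinear scale n br"
    and \<alpha>_linear: "Vector_Spaces.linear scale scale \<alpha>"
    and hom_nambu_identity: "\<And>xs ys. length xs = n - 1 \<Longrightarrow> length ys = n \<Longrightarrow>
      br (map \<alpha> xs @ [br ys]) = (\<Sum>i<n. br ((map \<alpha> ys)[i := br (xs @ [ys ! i])]))"

locale multiplicative_hom_nambu_algebra = hom_nambu_algebra scale n br \<alpha>
  for scale :: "'k::field \<Rightarrow> 'v::ab_group_add \<Rightarrow> 'v"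
    and n :: nat
    and br :: "'v list \<Rightarrow> 'v"
    and \<alpha> :: "'v \<Rightarrow> 'v" +
  assumes multiplicative: "\<And>xs. length xs = n \<Longrightarrow> \<alpha> (br xs) = br (map \<alpha> xs)"

text \<open>The base field, as a vector space over itself, has scalar multiplication \<open>(*)\<close>.\<close>

definition bilinear_form ::
  "('k::field \<Rightarrow> 'v::ab_group_add \<Rightarrow> 'v) \<Rightarrow> ('v \<Rightarrow> 'v \<Rightarrow> 'k) \<Rightarrow> bool"
  where "bilinear_form scale B \<longleftrightarrow>
    (\<forall>x. Vector_Spaces.linear scale (*) (\<lambda>y. B x y)) \<and>
    (\<forall>y. Vector_Spaces.linear scale (*) (\<lambda>x. B x y))"

definition symmetric_form :: "('v \<Rightarrow> 'v \<Rightarrow> 'k) \<Rightarrow> bool"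
  where "symmetric_form B \<longleftrightarrow> (\<forall>x y. B x y = B y x)"

text \<open>For symmetric forms the left and right radicals agree, so one of them suffices.\<close>

definition nondegenerate_form :: "('v::zero \<Rightarrow> 'v \<Rightarrow> 'k::zero) \<Rightarrow> bool"
  where "nondegenerate_form B \<longleftrightarrow> (\<forall>x. (\<forall>y. B x y = 0) \<longrightarrow> x = 0)"

locale hom_quadratic_hom_nambu_algebra = multiplicative_hom_nambu_algebra scale n br \<alpha>
  for scale :: "'k::field \<Rightarrow> 'v::ab_group_add \<Rightarrow> 'v"
    and n :: nat
    and br :: "'v list \<Rightarrow> 'v"
    and \<alpha> :: "'v \<Rightarrow> 'v" +
  fixes B :: "'v \<Rightarrow> 'v \<Rightarrow> 'k"
    and \<beta> :: "'v \<Rightarrow> 'v"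
  assumes B_bilinear: "bilinear_form scale B"
    and B_symmetric: "symmetric_form B"
    and B_nondegenerate: "nondegenerate_form B"
    and \<beta>_linear: "Vector_Spaces.linear scale scale \<beta>"
    and B_invariant: "\<And>xs y z. length xs = n - 1 \<Longrightarrow>
      B (br (xs @ [y])) (\<beta> z) + B (\<beta> y) (br (xs @ [z])) = 0"

text \<open>The iterated product \<open>[\<dots>]\<^sup>(\<^sup>k\<^sup>)\<close>, to be applied to lists of length \<open>2 ^ k * (n - 1) + 1\<close>:
  the first \<open>2 ^ (k - 1) * (n - 1) + 1\<close> arguments go into the inner product.\<close>

primrec iterated_product ::
  "nat \<Rightarrow> ('v \<Rightarrow> 'v) \<Rightarrow> ('v list \<Rightarrow> 'v) \<Rightarrow> nat \<Rightarrow> 'v list \<Rightarrow> 'v"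
  where
    "iterated_product n \<alpha> br 0 xs = br xs"
  | "iterated_product n \<alpha> br (Suc k) xs =
      iterated_product n \<alpha> br k
        (iterated_product n \<alpha> br k (take (2 ^ k * (n - 1) + 1) xs)
          # map (\<alpha> ^^ (2 ^ k)) (drop (2 ^ k * (n - 1) + 1) xs))"

end

theory Submission
  imports Defs
begin

text \<open>The products \<open>[\<dots>]\<^sup>(\<^sup>k\<^sup>)\<close> arise by iterating one construction that doubles \<open>n - 1\<close>: nest the bracket
  once, twisting the outer arguments by \<open>\<alpha>\<close>. Put \<open>z = ([x\<^sub>1, \<dots>, x\<^sub>n], \<alpha> x\<^sub>n\<^sub>+\<^sub>1, \<dots>, \<alpha> x\<^sub>2\<^sub>n\<^sub>-\<^sub>2)\<close>. The
  new adjoint operator is \<open>D y = [z, \<alpha> y]\<close>, so invariance of \<open>B\<close> is the old invariance at \<open>\<alpha> y\<close> and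
  \<open>\<alpha> y'\<close>. The new Hom-Nambu identity follows by applying the old one first for \<open>\<alpha> z\<close> to the outer
  bracket and then for \<open>z\<close> to the inner bracket.\<close>

definition doubled_product :: "nat \<Rightarrow> ('v \<Rightarrow> 'v) \<Rightarrow> ('v list \<Rightarrow> 'v) \<Rightarrow> 'v list \<Rightarrow> 'v"
  where "doubled_product n \<alpha> br xs = br (br (take n xs) # map \<alpha> (drop n xs))"

lemma sum_lessThan_add:
  fixes f :: "nat \<Rightarrow> 'a::comm_monoid_add"
  shows "(\<Sum>i<m + p. f i) = (\<Sum>i<m. f i) + (\<Sum>j<p. f (m + j))"
  by (induction p) (simp_all add: add.assoc)

lemma funpow_double: "f ^^ (2 * m) = f ^^ m \<circ> f ^^ m"
  by (simp add: funpow_add mult_2)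

lemma multilinear_linear:
  assumes "multilinear scale n br" "length xs = n" "i < n"
  shows "Vector_Spaces.linear scale scale (\<lambda>v. br (xs[i := v]))"
  using assms unfolding multilinear_def by blast

lemma multilinear_linear_hd:
  assumes "multilinear scale n br" "Suc (length ws) = n"
  shows "Vector_Spaces.linear scale scale (\<lambda>v. br (v # ws))"
  \<comment> \<open>The head \<open>undefined\<close> is only a placeholder: the update at position
    0 overwrites it.\<close>
  using multilinear_linear[OF assms(1), of "undefined # ws" 0] assms(2) by simp

text \<open>In each slot the map is a composite of two linear maps: an inner slot passes through
  both brackets, an outer slot through \<alpha> and then the outer bracket.\<close>

lemma doubled_product_multilinear:
  assumes ml: "multilinear scale n br" and \<alpha>: "Vector_Spaces.linear scale scale \<alpha>" and "n \<ge> 1"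
  shows "multilinear scale (2 * n - 1) (doubled_product n \<alpha> br)"
  unfolding multilinear_def
proof (intro allI impI)
  fix xs :: "'b list" and i
  assume len: "length xs = 2 * n - 1" and i: "i < 2 * n - 1"
  show "Vector_Spaces.linear scale scale (\<lambda>v. doubled_product n \<alpha> br (xs[i := v]))"
  proof (cases "i < n")
    case True
    let ?ws = "map \<alpha> (drop n xs)"
    have "Vector_Spaces.linear scale scale ((\<lambda>v. br (v # ?ws)) \<circ> (\<lambda>v. br ((take n xs)[i := v])))"
      using True len assms(3)
      by (intro Vector_Spaces.linear_compose[OF multilinear_linear[OF ml]
            multilinear_linear_hd[OF ml]]) auto
    then show ?thesis
      using True by (simp add: doubled_product_def o_def take_update_swap)
  next
    case False
    \<comment> \<open>The inner bracket occupies position 0 of the outer one, so argument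
      \<open>i\<close> lands at \<open>Suc (i - n)\<close>.\<close>
    let ?ws = "br (take n xs) # map \<alpha> (drop n xs)"
    have "Vector_Spaces.linear scale scale ((\<lambda>v. br (?ws[Suc (i - n) := v])) \<circ> \<alpha>)"
      using False len assms(3) i
      by (intro Vector_Spaces.linear_compose[OF \<alpha> multilinear_linear[OF ml]]) auto
    then show ?thesis
      using False by (simp add: doubled_product_def o_def drop_update_swap map_update)
  qed
qed

lemma (in multiplicative_hom_nambu_algebra) doubled_product_multiplicative:
  assumes "length xs = 2 * n - 1"
  shows "\<alpha> (doubled_product n \<alpha> br xs) = doubled_product n \<alpha> br (map \<alpha> xs)"
  using assms arity by (simp add: doubled_product_def multiplicative take_map drop_map)

lemma (in multiplicative_hom_nambu_algebra) doubled_product_hom_nambu_identity: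
  assumes xs: "length xs = 2 * n - 2" and ys: "length ys = 2 * n - 1"
  shows "doubled_product n \<alpha> br (map (\<alpha> \<circ> \<alpha>) xs @ [doubled_product n \<alpha> br ys]) =
    (\<Sum>i<2 * n - 1. doubled_product n \<alpha> br
      ((map (\<alpha> \<circ> \<alpha>) ys)[i := doubled_product n \<alpha> br (xs @ [ys ! i])]))"
proof -
  define z where "z = br (take n xs) # map \<alpha> (drop n xs)"
  define D where "D y = br (z @ [\<alpha> y])" for y
  define Y1 where "Y1 = take n ys"
  define Y2 where "Y2 = drop n ys"
  have n: "n \<ge> 2" by (rule arity)
  have lz: "length z = n - 1" using xs n by (simp add: z_def)
  have l1: "length Y1 = n" and l2: "length Y2 = n - 1"
    using ys n by (simp_all add: Y1_def Y2_def)
  have D: "doubled_product n \<alpha> br (xs @ [y]) = D y" for y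
    using xs n by (simp add: doubled_product_def D_def z_def)
  let ?a = "map \<alpha>"
  let ?W = "?a (?a (?a Y2))"
  have len_take: "length (take n xs) = n" using xs n by simp
  \<comment> \<open>Multiplicativity moves both twists inside the first entry of \<open>z\<close>,
    so twisting \<open>xs\<close> twice twists \<open>z\<close> twice.\<close>
  have zz: "map (\<alpha> \<circ> \<alpha>) z = br (map (\<alpha> \<circ> \<alpha>) (take n xs)) # map (\<alpha> \<circ> (\<alpha> \<circ> \<alpha>)) (drop n xs)"
    using len_take by (simp add: z_def multiplicative o_assoc)
  have "doubled_product n \<alpha> br (map (\<alpha> \<circ> \<alpha>) xs @ [doubled_product n \<alpha> br ys]) =
      br (?a (?a z) @ [\<alpha> (br (br Y1 # ?a Y2))])"
    using xs n by (simp add: doubled_product_def zz Y1_def Y2_def take_map drop_map)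
  also have "\<alpha> (br (br Y1 # ?a Y2)) = br (br (?a Y1) # ?a (?a Y2))"
    using l1 l2 n by (simp add: multiplicative)
  \<comment> \<open>First use of the Hom-Nambu identity, with \<open>map \<alpha> z\<close> as the
    acting arguments.\<close>
  also have "br (?a (?a z) @ [br (br (?a Y1) # ?a (?a Y2))]) =
      (\<Sum>i<n. br ((\<alpha> (br (?a Y1)) # ?W)[i := br (?a z @ [(br (?a Y1) # ?a (?a Y2)) ! i])]))"
    using lz l2 n by (subst hom_nambu_identity) simp_all
  \<comment> \<open>The term at position 0 acts on the inner bracket; the other \<open>n - 1\<close>
    terms act on the outer arguments.\<close>
  also have "\<dots> = br (br (?a z @ [br (?a Y1)]) # ?W) +
      (\<Sum>j<n - 1. br (\<alpha> (br (?a Y1)) # ?W[j := br (?a z @ [?a (?a Y2) ! j])]))"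
    using sum.lessThan_Suc_shift[of "\<lambda>i. br ((\<alpha> (br (?a Y1)) # ?W)
      [i := br (?a z @ [(br (?a Y1) # ?a (?a Y2)) ! i])])" "n - 1"] n
    by simp
  \<comment> \<open>Second use, now with \<open>z\<close> itself acting; the single \<alpha> left on
    \<open>Y1\<close> is the one required by \<open>D\<close>.\<close>
  also have "br (?a z @ [br (?a Y1)]) = (\<Sum>i<n. br ((?a (?a Y1))[i := D (Y1 ! i)]))"
    using lz l1 by (subst hom_nambu_identity) (simp_all add: D_def)
  also have "br ((\<Sum>i<n. br ((?a (?a Y1))[i := D (Y1 ! i)])) # ?W) =
      (\<Sum>i<n. br (br ((?a (?a Y1))[i := D (Y1 ! i)]) # ?W))"
  proof -
    have "Vector_Spaces.linear scale scale (\<lambda>v. br (v # ?W))"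
      using l2 n by (intro multilinear_linear_hd[OF br_multilinear]) simp
    then show ?thesis
      by (rule module_hom.sum[OF Vector_Spaces.linear.axioms(3)])
  qed
  also have "\<dots> = (\<Sum>i<n. doubled_product n \<alpha> br ((map (\<alpha> \<circ> \<alpha>) ys)[i := D (ys ! i)]))"
    using ys n
    by (intro sum.cong)
      (simp_all add: doubled_product_def Y1_def Y2_def take_update_swap take_map drop_map)
  also have "(\<Sum>j<n - 1. br (\<alpha> (br (?a Y1)) # ?W[j := br (?a z @ [?a (?a Y2) ! j])])) =
      (\<Sum>j<n - 1. doubled_product n \<alpha> br ((map (\<alpha> \<circ> \<alpha>) ys)[n + j := D (ys ! (n + j))]))"
  proof (intro sum.cong refl)
    fix j assume j: "j \<in> {..<n - 1}"
    \<comment> \<open>Here \<alpha> is pulled out of the bracket: the doubled product applies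
      exactly this \<alpha> to its outer arguments.\<close>
    have "br (?a z @ [?a (?a Y2) ! j]) = \<alpha> (D (ys ! (n + j)))"
      using j l2 lz n ys by (simp add: D_def multiplicative Y2_def)
    moreover have "\<alpha> (br (?a Y1)) = br (?a (?a Y1))"
      using l1 by (simp add: multiplicative)
    ultimately show "br (\<alpha> (br (?a Y1)) # ?W[j := br (?a z @ [?a (?a Y2) ! j])]) =
        doubled_product n \<alpha> br ((map (\<alpha> \<circ> \<alpha>) ys)[n + j := D (ys ! (n + j))])"
      by (simp add: doubled_product_def Y1_def Y2_def drop_update_swap take_map drop_map map_update)
  qed
  also have "(\<Sum>i<n. doubled_product n \<alpha> br ((map (\<alpha> \<circ> \<alpha>) ys)[i := D (ys ! i)])) + \<dots> =
      (\<Sum>i<2 * n - 1. doubled_product n \<alpha> br ((map (\<alpha> \<circ> \<alpha>) ys)[i := D (ys ! i)]))"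
  proof -
    have "2 * n - 1 = n + (n - 1)" using n by simp
    then show ?thesis by (simp only: sum_lessThan_add)
  qed
  finally show ?thesis by (simp only: D)
qed

lemma (in hom_quadratic_hom_nambu_algebra) doubled_product_invariant:
  assumes "length xs = 2 * n - 2"
  shows "B (doubled_product n \<alpha> br (xs @ [y])) ((\<beta> \<circ> \<alpha>) z) +
    B ((\<beta> \<circ> \<alpha>) y) (doubled_product n \<alpha> br (xs @ [z])) = 0"
  using B_invariant[of "br (take n xs) # map \<alpha> (drop n xs)" "\<alpha> y" "\<alpha> z"] assms arity
  by (simp add: doubled_product_def)

text \<open>The result is a structure of the same kind on the same space with the same
  \<open>B\<close>, so the construction can be repeated.\<close>

lemma (in hom_quadratic_hom_nambu_algebra) hom_quadratic_doubled_product: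
  "hom_quadratic_hom_nambu_algebra scale (2 * n - 1) (doubled_product n \<alpha> br) (\<alpha> \<circ> \<alpha>) B (\<beta> \<circ> \<alpha>)"
proof (intro hom_quadratic_hom_nambu_algebra.intro multiplicative_hom_nambu_algebra.intro
    hom_nambu_algebra.intro hom_quadratic_hom_nambu_algebra_axioms.intro
    multiplicative_hom_nambu_algebra_axioms.intro hom_nambu_algebra_axioms.intro)
  show "2 * n - 1 \<ge> 2" using arity by simp
  show "multilinear scale (2 * n - 1) (doubled_product n \<alpha> br)"
    using arity by (intro doubled_product_multilinear br_multilinear \<alpha>_linear) simp
  show "Vector_Spaces.linear scale scale (\<alpha> \<circ> \<alpha>)"
    by (rule Vector_Spaces.linear_compose[OF \<alpha>_linear \<alpha>_linear])
  show "Vector_Spaces.linear scale scale (\<beta> \<circ> \<alpha>)"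
    by (rule Vector_Spaces.linear_compose[OF \<alpha>_linear \<beta>_linear])
  show "(\<alpha> \<circ> \<alpha>) (doubled_product n \<alpha> br xs) = doubled_product n \<alpha> br (map (\<alpha> \<circ> \<alpha>) xs)"
    if "length xs = 2 * n - 1" for xs
    using that doubled_product_multiplicative[of xs] doubled_product_multiplicative[of "map \<alpha> xs"]
    by simp
  show "doubled_product n \<alpha> br (map (\<alpha> \<circ> \<alpha>) xs @ [doubled_product n \<alpha> br ys]) =
    (\<Sum>i<2 * n - 1. doubled_product n \<alpha> br
      ((map (\<alpha> \<circ> \<alpha>) ys)[i := doubled_product n \<alpha> br (xs @ [ys ! i])]))"
    if "length xs = 2 * n - 1 - 1" "length ys = 2 * n - 1" for xs ys
    using that by (intro doubled_product_hom_nambu_identity) simp_all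
  show "B (doubled_product n \<alpha> br (xs @ [y])) ((\<beta> \<circ> \<alpha>) z) +
    B ((\<beta> \<circ> \<alpha>) y) (doubled_product n \<alpha> br (xs @ [z])) = 0"
    if "length xs = 2 * n - 1 - 1" for xs y z
    using that by (intro doubled_product_invariant) simp
qed (rule vector_space_axioms B_bilinear B_symmetric B_nondegenerate)+

text \<open>Identifies the recursion with doubling at the current arity and twist, as an equality of
  functions so that it can be rewritten inside the locale predicate.\<close>

lemma iterated_product_Suc:
  "iterated_product n \<alpha> br (Suc k) =
    doubled_product (2 ^ k * (n - 1) + 1) (\<alpha> ^^ (2 ^ k)) (iterated_product n \<alpha> br k)"
  by (rule ext) (simp add: doubled_product_def)

text \<open>Induction from the given algebra at \<open>k = 0\<close>, where the exponent
  \<open>2 ^ 0 - 1\<close> vanishes and leaves \<beta> untwisted; each step is one doubling.\<close>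

lemma hom_quadratic_iterated_product:
  assumes "hom_quadratic_hom_nambu_algebra scale n br \<alpha> B \<beta>"
  shows "hom_quadratic_hom_nambu_algebra scale (2 ^ k * (n - 1) + 1)
    (iterated_product n \<alpha> br k) (\<alpha> ^^ (2 ^ k)) B (\<beta> \<circ> \<alpha> ^^ (2 ^ k - 1))"
proof (induction k)
  case 0
  interpret hom_quadratic_hom_nambu_algebra scale n br \<alpha> B \<beta> by (rule assms)
  have "iterated_product n \<alpha> br 0 = br" by (rule ext) simp
  moreover have "2 ^ 0 * (n - 1) + 1 = n" using arity by simp
  ultimately show ?case using assms by simp
next
  case (Suc k)
  have arity: "2 * (2 ^ k * (n - 1) + 1) - 1 = 2 ^ Suc k * (n - 1) + 1"
    by simp
  \<comment> \<open>Doubling composes the form's twist with the current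
    \<open>\<alpha> ^^ (2 ^ k)\<close>, so the exponents accumulate as 1 + 2 + 4 + ..., which gives
    \<open>2 ^ k - 1\<close> after \<open>k\<close> steps.\<close>
  have "(2::nat) ^ Suc k - 1 = (2 ^ k - 1) + 2 ^ k" by simp
  then have twist: "(\<beta> \<circ> \<alpha> ^^ (2 ^ k - 1)) \<circ> \<alpha> ^^ (2 ^ k) = \<beta> \<circ> \<alpha> ^^ (2 ^ Suc k - 1)"
    by (simp only: funpow_add o_assoc)
  have "\<alpha> ^^ (2 ^ k) \<circ> \<alpha> ^^ (2 ^ k) = \<alpha> ^^ (2 ^ Suc k)"
    by (simp add: funpow_double)
  with hom_quadratic_hom_nambu_algebra.hom_quadratic_doubled_product[OF Suc.IH] arity twist
  show ?case by (simp only: iterated_product_Suc)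
qed

theorem corollary5p11:
  fixes scale :: "'k::{alg_closed_field, field_char_0} \<Rightarrow> 'v::ab_group_add \<Rightarrow> 'v"
    and n k :: nat
    and br :: "'v list \<Rightarrow> 'v"
    and \<alpha> \<beta> :: "'v \<Rightarrow> 'v"
    and B :: "'v \<Rightarrow> 'v \<Rightarrow> 'k"
  assumes "hom_quadratic_hom_nambu_algebra scale n br \<alpha> B \<beta>"
    and "k \<ge> 1"
  shows "hom_quadratic_hom_nambu_algebra scale (2 ^ k * (n - 1) + 1)
    (iterated_product n \<alpha> br k) (\<alpha> ^^ (2 ^ k)) B (\<beta> \<circ> \<alpha> ^^ (2 ^ k - 1))"
  using assms(1) by (rule hom_quadratic_iterated_product)

end
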